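(* Let $B$ be a unital commutative regular Banach algebra such that the diagonal is a set of spectral synthesis for the Banach algebra $B\hat{\otimes}B$. Then $\overline{\mathcal{T}_{Lie}(B)}=\overline{\mathcal{N}_{Lie}(B)}$, where the closures are taken in $B\hat{\otimes}B$.
   Context: $\hat{\otimes}$ is the projective tensor product. For commutative unital $B$, $\mathcal{T}_{Lie}(B)$ is the subalgebra (not required to contain the unit) of $B\otimes B$ generated by all elements $a\otimes1-1\otimes a$, $a\in B$, and $\mathcal{N}_{Lie}(B)$ is the algebra of all finite tensors $\sum_k a_k\otimes b_k\in B\otimes B$ with $\sum_k a_kb_k=0$; both are regarded as subsets of $B\hat{\otimes}B$. The character space of $B\hat{\otimes}B$ is $\Omega\times\Omega$, where $\Omega$ is the character space of $B$; the diagonal is $\Delta=\{(x,x):x\in\Omega\}$. $B$ is regular if for every closed $E\subset\Omega$ and $x\in\Omega\setminus E$ some element of $B$ has Gelfand transform vanishing on $E$ and not at $x$. A closed subset $E$ of the character space of a regular commutative Banach algebra is a set of spectral synthesis if there is exactly one closed ideal whose hull (the set of common zeros of the Gelfand transforms of its elements) equals $E$. *)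

theory Defs
  imports "HOL-Analysis.Analysis"
begin

section \<open>Commutative unital complex algebras and Banach algebras\<close>

class scaleC =
  fixes scaleC :: "complex \<Rightarrow> 'a \<Rightarrow> 'a"  (infixr \<open>*\<^sub>C\<close> 75)

class complex_comm_algebra_1 = scaleC + comm_ring_1 +
  assumes scaleC_add_right: "c *\<^sub>C (x + y) = c *\<^sub>C x + c *\<^sub>C y"
    and scaleC_add_left: "(c + d) *\<^sub>C x = c *\<^sub>C x + d *\<^sub>C x"
    and scaleC_scaleC: "c *\<^sub>C d *\<^sub>C x = (c * d) *\<^sub>C x"
    and scaleC_one: "1 *\<^sub>C x = x"
    and mult_scaleC_left: "c *\<^sub>C x * y = c *\<^sub>C (x * y)"

text \<open>The norm of the unit is not required to be 1.\<close>

class complex_comm_banach_algebra_1 = complex_comm_algebra_1 + real_normed_algebra + banach +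
  assumes scaleR_scaleC: "r *\<^sub>R x = of_real r *\<^sub>C x"
    and norm_scaleC: "norm (c *\<^sub>C x) = cmod c * norm x"

lemma vector_space_scaleC: "vector_space (scaleC :: complex \<Rightarrow> 'a::complex_comm_algebra_1 \<Rightarrow> 'a)"
  by standard (simp_all add: scaleC_add_right scaleC_add_left scaleC_scaleC scaleC_one)

lemma scaleC_zero_left [simp]: "0 *\<^sub>C x = (0::'a::complex_comm_algebra_1)"
  using scaleC_add_left[of 0 0 x] by simp

lemma scaleC_zero_right [simp]: "c *\<^sub>C 0 = (0::'a::complex_comm_algebra_1)"
  using scaleC_add_right[of c "0::'a" 0] by simp

lemma scaleC_minus1 [simp]: "(-1) *\<^sub>C x = - (x::'a::complex_comm_algebra_1)"
proof -
  have "(1 + (-1)) *\<^sub>C x = x + (-1) *\<^sub>C x"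
    unfolding scaleC_add_left scaleC_one ..
  then show ?thesis by (simp add: eq_neg_iff_add_eq_0 add.commute)
qed

definition clinear :: "('a::complex_comm_algebra_1 \<Rightarrow> complex) \<Rightarrow> bool" where
  "clinear f \<longleftrightarrow> (\<forall>x y. f (x + y) = f x + f y) \<and> (\<forall>c x. f (c *\<^sub>C x) = c * f x)"

definition cbilinear :: "('a::complex_comm_algebra_1 \<Rightarrow> 'a \<Rightarrow> complex) \<Rightarrow> bool" where
  "cbilinear A \<longleftrightarrow> (\<forall>a. clinear (\<lambda>b. A a b)) \<and> (\<forall>b. clinear (\<lambda>a. A a b))"

lemma clinear_separates:
  fixes x :: "'a::complex_comm_algebra_1"
  assumes "x \<noteq> 0"
  obtains f where "clinear f" "f x \<noteq> 0"
proof -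
  interpret V: vector_space "scaleC :: complex \<Rightarrow> 'a \<Rightarrow> 'a" by (rule vector_space_scaleC)
  interpret W: vector_space "(*) :: complex \<Rightarrow> complex \<Rightarrow> complex"
    by standard (simp_all add: algebra_simps)
  interpret P: vector_space_pair "scaleC :: complex \<Rightarrow> 'a \<Rightarrow> 'a" "(*) :: complex \<Rightarrow> complex \<Rightarrow> complex" ..
  have ind: "V.independent {x}" using assms by simp
  have "Vector_Spaces.linear scaleC (*) (P.construct {x} (\<lambda>_. 1))"
    by (rule P.linear_construct[OF ind])
  then interpret L: Vector_Spaces.linear scaleC "(*)" "P.construct {x} (\<lambda>_. 1)" .
  show thesis
  proof
    show "clinear (P.construct {x} (\<lambda>_. 1))"
      unfolding clinear_def using L.add L.scale by blast
    show "P.construct {x} (\<lambda>_. 1) x \<noteq> 0"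
      using P.construct_basis[OF ind, of x "\<lambda>_. 1"] by simp
  qed
qed

section \<open>The algebraic tensor product\<close>

text \<open>
  The pure tensor of \<open>a\<close> and \<open>b\<close> is the evaluation \<open>A \<mapsto> A a b\<close> of complex bilinear forms,
  and \<open>B \<otimes> B\<close> is the span of the pure tensors; a scalar coefficient
  is absorbed into the first factor. Off the bilinear forms the functionals are set to 0.
\<close>

definition form_eval :: "('a::complex_comm_algebra_1 \<times> 'a) list \<Rightarrow> ('a \<Rightarrow> 'a \<Rightarrow> complex) \<Rightarrow> complex" where
  "form_eval xs A = (if cbilinear A then \<Sum>(a, b)\<leftarrow>xs. A a b else 0)"

typedef (overloaded) 'a tensor =
  "range (form_eval :: ('a::complex_comm_algebra_1 \<times> 'a) list \<Rightarrow> _)"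
  by blast

setup_lifting type_definition_tensor

lift_definition pure :: "'a \<Rightarrow> 'a \<Rightarrow> 'a::complex_comm_algebra_1 tensor"  (infixl \<open>\<otimes>\<^sub>t\<close> 75)
  is "\<lambda>a b. form_eval [(a, b)]"
  by blast

lemma form_eval_off: "\<not> cbilinear A \<Longrightarrow> form_eval xs A = 0"
  by (simp add: form_eval_def)

lemma form_eval_Nil [simp]: "form_eval [] A = 0"
  by (simp add: form_eval_def)

lemma form_eval_append: "form_eval (xs @ ys) A = form_eval xs A + form_eval ys A"
  by (simp add: form_eval_def)

lemma form_eval_scale:
  "form_eval (map (\<lambda>(a, b). (c *\<^sub>C a, b)) xs) A = c * form_eval xs A"
  by (induction xs) (auto simp: form_eval_def cbilinear_def clinear_def algebra_simps)

lemma cbilinear_add: "cbilinear A \<Longrightarrow> cbilinear B \<Longrightarrow> cbilinear (\<lambda>a b. A a b + B a b)"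
  by (simp add: cbilinear_def clinear_def algebra_simps)

lemma cbilinear_zero: "cbilinear (\<lambda>a b. 0)"
  by (simp add: cbilinear_def clinear_def)

lemma form_eval_form_add:
  assumes "cbilinear A" "cbilinear B"
  shows "form_eval xs (\<lambda>a b. A a b + B a b) = form_eval xs A + form_eval xs B"
proof -
  have "(\<Sum>(a, b)\<leftarrow>xs. A a b + B a b) = (\<Sum>(a, b)\<leftarrow>xs. A a b) + (\<Sum>(a, b)\<leftarrow>xs. B a b)"
    by (induction xs) auto
  then show ?thesis
    using assms cbilinear_add[OF assms] by (simp add: form_eval_def)
qed

lemma scaleC_commute: "c *\<^sub>C d *\<^sub>C x = d *\<^sub>C c *\<^sub>C (x::'a::complex_comm_algebra_1)"
  by (simp add: scaleC_scaleC mult.commute)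

lemma mult_scaleC_right: "x * c *\<^sub>C y = c *\<^sub>C (x * (y::'a::complex_comm_algebra_1))"
  by (metis mult.commute mult_scaleC_left)

lemma cbilinear_shift_fix:
  "cbilinear A \<Longrightarrow> cbilinear (\<lambda>c d. A (a * c) (b * d))"
  by (simp add: cbilinear_def clinear_def distrib_left mult_scaleC_right)

lemma cbilinear_shift:
  assumes "cbilinear A"
  shows "cbilinear (\<lambda>a b. form_eval ys (\<lambda>c d. A (a * c) (b * d)))"
proof (induction ys)
  case Nil
  show ?case by (simp add: cbilinear_zero)
next
  case (Cons y ys)
  obtain c d where y: "y = (c, d)" by (cases y)
  have "(\<lambda>a b. form_eval (y # ys) (\<lambda>c d. A (a * c) (b * d))) =
        (\<lambda>a b. A (a * c) (b * d) + form_eval ys (\<lambda>c d. A (a * c) (b * d)))"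
    using cbilinear_shift_fix[OF assms] by (simp add: form_eval_def y)
  moreover have "cbilinear (\<lambda>a b. A (a * c) (b * d))"
    using assms by (simp add: cbilinear_def clinear_def distrib_right mult_scaleC_left)
  ultimately show ?case using Cons cbilinear_add by simp
qed

text \<open>The product is determined by \<open>(a \<otimes> b) (c \<otimes> d) = ac \<otimes> bd\<close>, see \<open>pure_mult\<close> below.\<close>

definition form_times ::
  "(('a \<Rightarrow> 'a \<Rightarrow> complex) \<Rightarrow> complex) \<Rightarrow> (('a \<Rightarrow> 'a \<Rightarrow> complex) \<Rightarrow> complex) \<Rightarrow>
   ('a::complex_comm_algebra_1 \<Rightarrow> 'a \<Rightarrow> complex) \<Rightarrow> complex" where
  "form_times u v A = (if cbilinear A then u (\<lambda>a b. v (\<lambda>c d. A (a * c) (b * d))) else 0)"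

lemma form_times_eval:
  "form_times (form_eval xs) (form_eval ys) =
   form_eval (concat (map (\<lambda>(a, b). map (\<lambda>(c, d). (a * c, b * d)) ys) xs))"
proof
  fix A :: "'a \<Rightarrow> 'a \<Rightarrow> complex"
  show "form_times (form_eval xs) (form_eval ys) A =
        form_eval (concat (map (\<lambda>(a, b). map (\<lambda>(c, d). (a * c, b * d)) ys) xs)) A"
  proof (cases "cbilinear A")
    case True
    have inner: "(\<Sum>(c, d)\<leftarrow>map (\<lambda>(c, d). (a * c, b * d)) ys. A c d) =
        form_eval ys (\<lambda>c d. A (a * c) (b * d))" for a b
      using cbilinear_shift_fix[OF True, of a b]
      by (simp add: form_eval_def split_def o_def)
    have "(\<Sum>(a, b)\<leftarrow>xs. form_eval ys (\<lambda>c d. A (a * c) (b * d))) =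
        (\<Sum>(a, b)\<leftarrow>concat (map (\<lambda>(a, b). map (\<lambda>(c, d). (a * c, b * d)) ys) xs). A a b)"
      by (induction xs) (auto simp: inner[symmetric] simp del: map_map)
    then show ?thesis
      using True cbilinear_shift[OF True, of ys]
      by (simp add: form_times_def form_eval_def[of xs] form_eval_def[of "concat _"])
  qed (simp add: form_times_def form_eval_def)
qed

instantiation tensor :: (complex_comm_algebra_1) "{ab_group_add, times, one, scaleC}"
begin

lift_definition zero_tensor :: "'a tensor" is "\<lambda>_. 0"
  by (rule range_eqI[of _ _ "[]"]) (auto simp: form_eval_def)

lift_definition one_tensor :: "'a tensor" is "form_eval [(1, 1)]"
  by blast

lift_definition plus_tensor :: "'a tensor \<Rightarrow> 'a tensor \<Rightarrow> 'a tensor" is "\<lambda>u v A. u A + v A"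
proof -
  fix u v :: "('a \<Rightarrow> 'a \<Rightarrow> complex) \<Rightarrow> complex"
  assume "u \<in> range form_eval" "v \<in> range form_eval"
  then obtain xs ys where "u = form_eval xs" "v = form_eval ys" by blast
  then show "(\<lambda>A. u A + v A) \<in> range form_eval"
    by (intro range_eqI[of _ _ "xs @ ys"]) (auto simp: form_eval_append)
qed

lift_definition scaleC_tensor :: "complex \<Rightarrow> 'a tensor \<Rightarrow> 'a tensor" is "\<lambda>c u A. c * u A"
proof -
  fix c and u :: "('a \<Rightarrow> 'a \<Rightarrow> complex) \<Rightarrow> complex"
  assume "u \<in> range form_eval"
  then obtain xs where "u = form_eval xs" by blast
  then show "(\<lambda>A. c * u A) \<in> range form_eval"
    by (intro range_eqI[of _ _ "map (\<lambda>(a, b). (c *\<^sub>C a, b)) xs"]) (auto simp: form_eval_scale)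
qed

definition uminus_tensor :: "'a tensor \<Rightarrow> 'a tensor" where "uminus_tensor u = (-1) *\<^sub>C u"

definition minus_tensor :: "'a tensor \<Rightarrow> 'a tensor \<Rightarrow> 'a tensor" where "minus_tensor u v = u + - v"

lift_definition times_tensor :: "'a tensor \<Rightarrow> 'a tensor \<Rightarrow> 'a tensor" is form_times
  by (force simp: form_times_eval)

instance
proof
  fix u v w :: "'a tensor"
  show "u + v + w = u + (v + w)" by transfer (simp add: add.assoc)
  show "u + v = v + u" by transfer (simp add: add.commute)
  show "0 + u = u" by transfer simp
  show "- u + u = 0" unfolding uminus_tensor_def by transfer simp
  show "u - v = u + - v" by (rule minus_tensor_def)
qed

end

lemma Rep_tensor_sum: "Rep_tensor (\<Sum>(a, b)\<leftarrow>xs. a \<otimes>\<^sub>t b) = form_eval xs"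
proof (induction xs)
  case Nil
  show ?case by (auto simp: form_eval_def zero_tensor.rep_eq)
next
  case (Cons x xs)
  then show ?case
    by (cases x) (auto simp: plus_tensor.rep_eq pure.rep_eq form_eval_def)
qed

lemma tensor_sum_of_pure:
  obtains xs where "u = (\<Sum>(a, b)\<leftarrow>xs. a \<otimes>\<^sub>t b)"
proof -
  obtain xs where "Rep_tensor u = form_eval xs" using Rep_tensor[of u] by blast
  then have "u = (\<Sum>(a, b)\<leftarrow>xs. a \<otimes>\<^sub>t b)" by (metis Rep_tensor_sum Rep_tensor_inject)
  then show thesis by (rule that)
qed

lemma tensor_induct [case_names zero add]:
  assumes "P 0" "\<And>a b u. P u \<Longrightarrow> P (a \<otimes>\<^sub>t b + u)"
  shows "P u"
proof -
  obtain xs where "u = (\<Sum>(a, b)\<leftarrow>xs. a \<otimes>\<^sub>t b)" by (rule tensor_sum_of_pure)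
  moreover have "P (\<Sum>(a, b)\<leftarrow>xs. a \<otimes>\<^sub>t b)"
    by (induction xs) (auto intro: assms)
  ultimately show ?thesis by simp
qed

lemma pure_add_left: "(a + a') \<otimes>\<^sub>t b = a \<otimes>\<^sub>t b + a' \<otimes>\<^sub>t b"
  by transfer (auto simp: form_eval_def cbilinear_def clinear_def)

lemma pure_add_right: "a \<otimes>\<^sub>t (b + b') = a \<otimes>\<^sub>t b + a \<otimes>\<^sub>t b'"
  by transfer (auto simp: form_eval_def cbilinear_def clinear_def)

lemma pure_scale_left: "(c *\<^sub>C a) \<otimes>\<^sub>t b = c *\<^sub>C (a \<otimes>\<^sub>t b)"
  by transfer (auto simp: form_eval_def cbilinear_def clinear_def)

lemma pure_scale_right: "a \<otimes>\<^sub>t (c *\<^sub>C b) = c *\<^sub>C (a \<otimes>\<^sub>t b)"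
  by transfer (auto simp: form_eval_def cbilinear_def clinear_def)

lemma pure_mult: "(a \<otimes>\<^sub>t b) * (c \<otimes>\<^sub>t d) = (a * c) \<otimes>\<^sub>t (b * d)"
  by transfer (simp add: form_times_eval)

lemma one_tensor: "1 = 1 \<otimes>\<^sub>t 1"
  by transfer simp

lemma tensor_distrib_right: "(u + v) * w = u * w + v * (w :: 'a::complex_comm_algebra_1 tensor)"
  by transfer (auto simp: form_times_def)

lemma tensor_distrib_left: "w * (u + v) = w * u + w * (v :: 'a::complex_comm_algebra_1 tensor)"
proof (transfer, intro ext)
  fix w u v :: "('a \<Rightarrow> 'a \<Rightarrow> complex) \<Rightarrow> complex" and A :: "'a \<Rightarrow> 'a \<Rightarrow> complex"
  assume "w \<in> range form_eval" "u \<in> range form_eval" "v \<in> range form_eval"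
  then obtain xs ys zs where *: "w = form_eval zs" "u = form_eval xs" "v = form_eval ys" by blast
  show "form_times w (\<lambda>A. u A + v A) A = form_times w u A + form_times w v A"
  proof (cases "cbilinear A")
    case True
    then show ?thesis
      using form_eval_form_add[OF cbilinear_shift[OF True, of xs] cbilinear_shift[OF True, of ys]]
      by (simp add: form_times_def *)
  qed (simp add: form_times_def)
qed

lemma tensor_zero_left: "0 * u = (0 :: 'a::complex_comm_algebra_1 tensor)"
  by transfer (auto simp: form_times_def)

lemma tensor_zero_right: "u * 0 = (0 :: 'a::complex_comm_algebra_1 tensor)"
  using tensor_distrib_left[of u 0 0] by simp

lemma tensor_commute: "u * v = v * (u :: 'a::complex_comm_algebra_1 tensor)"
proof (induction u rule: tensor_induct)
  case zero
  show ?case by (simp add: tensor_zero_left tensor_zero_right)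
next
  case (add a b u)
  have "a \<otimes>\<^sub>t b * v = v * (a \<otimes>\<^sub>t b)"
    by (induction v rule: tensor_induct)
      (simp_all add: tensor_zero_left tensor_zero_right tensor_distrib_left tensor_distrib_right
        pure_mult mult.commute)
  with add show ?case by (simp add: tensor_distrib_left tensor_distrib_right)
qed

lemma tensor_assoc: "u * v * w = u * (v * (w :: 'a::complex_comm_algebra_1 tensor))"
proof (induction u rule: tensor_induct)
  case zero
  show ?case by (simp add: tensor_zero_left)
next
  case (add a b u)
  have "a \<otimes>\<^sub>t b * v * w = a \<otimes>\<^sub>t b * (v * w)"
  proof (induction v rule: tensor_induct)
    case zero
    show ?case by (simp add: tensor_zero_left tensor_zero_right)
  next
    case (add c d v)
    have "a \<otimes>\<^sub>t b * (c \<otimes>\<^sub>t d) * w = a \<otimes>\<^sub>t b * (c \<otimes>\<^sub>t d * w)"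
      by (induction w rule: tensor_induct)
        (simp_all add: tensor_zero_left tensor_zero_right tensor_distrib_left tensor_distrib_right
          pure_mult mult.assoc)
    with add show ?case by (simp add: tensor_distrib_left tensor_distrib_right)
  qed
  with add show ?case by (simp add: tensor_distrib_right)
qed

lemma tensor_one_left: "1 * u = (u :: 'a::complex_comm_algebra_1 tensor)"
  by (induction u rule: tensor_induct)
    (simp_all add: one_tensor tensor_zero_right tensor_distrib_left pure_mult)

lemma pure_one_nonzero: "1 \<otimes>\<^sub>t 1 \<noteq> (0 :: 'a::complex_comm_algebra_1 tensor)"
proof -
  obtain f :: "'a \<Rightarrow> complex" where f: "clinear f" "f 1 \<noteq> 0"
    by (rule clinear_separates[OF one_neq_zero])
  have "cbilinear (\<lambda>a b. f a * f b)"
    using f(1) by (simp add: cbilinear_def clinear_def algebra_simps)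
  then have "form_eval [(1, 1)] (\<lambda>a b. f a * f b) \<noteq> 0"
    using f(2) by (simp add: form_eval_def)
  then show ?thesis by transfer (auto simp: fun_eq_iff)
qed

instance tensor :: (complex_comm_algebra_1) complex_comm_algebra_1
proof
  fix u v w :: "'a tensor" and c d :: complex
  show "u * v * w = u * (v * w)" by (rule tensor_assoc)
  show "u * v = v * u" by (rule tensor_commute)
  show "1 * u = u" by (rule tensor_one_left)
  show "(u + v) * w = u * w + v * w" by (rule tensor_distrib_right)
  show "(0 :: 'a tensor) \<noteq> 1" using pure_one_nonzero by (metis one_tensor)
  show "c *\<^sub>C (u + v) = c *\<^sub>C u + c *\<^sub>C v" by transfer (simp add: fun_eq_iff algebra_simps)
  show "(c + d) *\<^sub>C u = c *\<^sub>C u + d *\<^sub>C u" by transfer (simp add: fun_eq_iff algebra_simps)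
  show "c *\<^sub>C d *\<^sub>C u = (c * d) *\<^sub>C u" by transfer (simp add: fun_eq_iff algebra_simps)
  show "1 *\<^sub>C u = u" by transfer (simp add: fun_eq_iff)
  show "c *\<^sub>C u * v = c *\<^sub>C (u * v)" by transfer (simp add: fun_eq_iff form_times_def)
qed

lifting_forget tensor.lifting

section \<open>The projective norm\<close>

definition proj_norm :: "'a::complex_comm_banach_algebra_1 tensor \<Rightarrow> real" where
  "proj_norm u = Inf {\<Sum>(a, b)\<leftarrow>xs. norm a * norm b | xs. u = (\<Sum>(a, b)\<leftarrow>xs. a \<otimes>\<^sub>t b)}"

lemma cost_nonneg: "0 \<le> (\<Sum>(a, b)\<leftarrow>xs. norm a * norm b)"
  by (induction xs) auto

lemma proj_norm_le:
  assumes "u = (\<Sum>(a, b)\<leftarrow>xs. a \<otimes>\<^sub>t b)"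
  shows "proj_norm u \<le> (\<Sum>(a, b)\<leftarrow>xs. norm a * norm b)"
  unfolding proj_norm_def using assms
  by (intro cInf_lower bdd_belowI[of _ 0]) (auto simp: cost_nonneg)

lemma proj_norm_ge:
  assumes "\<And>xs. u = (\<Sum>(a, b)\<leftarrow>xs. a \<otimes>\<^sub>t b) \<Longrightarrow> r \<le> (\<Sum>(a, b)\<leftarrow>xs. norm a * norm b)"
  shows "r \<le> proj_norm u"
  unfolding proj_norm_def
proof (rule cInf_greatest)
  obtain xs where "u = (\<Sum>(a, b)\<leftarrow>xs. a \<otimes>\<^sub>t b)" by (rule tensor_sum_of_pure)
  then show "{\<Sum>(a, b)\<leftarrow>xs. norm a * norm b | xs. u = (\<Sum>(a, b)\<leftarrow>xs. a \<otimes>\<^sub>t b)} \<noteq> {}" by blast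
qed (use assms in blast)

lemma proj_norm_nonneg: "0 \<le> proj_norm u"
  by (rule proj_norm_ge) (rule cost_nonneg)

lemma proj_norm_approx:
  assumes "proj_norm u < r"
  obtains xs where "u = (\<Sum>(a, b)\<leftarrow>xs. a \<otimes>\<^sub>t b)" "(\<Sum>(a, b)\<leftarrow>xs. norm a * norm b) < r"
  using assms proj_norm_ge[of u r] by fastforce

lemma proj_norm_zero [simp]: "proj_norm (0 :: 'a::complex_comm_banach_algebra_1 tensor) = 0"
proof (rule antisym)
  show "proj_norm (0 :: 'a tensor) \<le> 0" using proj_norm_le[of 0 "[]"] by simp
qed (rule proj_norm_nonneg)

lemma proj_norm_pure_le: "proj_norm (a \<otimes>\<^sub>t b) \<le> norm a * norm b"
  using proj_norm_le[of "a \<otimes>\<^sub>t b" "[(a, b)]"] by simp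

lemma proj_norm_add: "proj_norm (u + v) \<le> proj_norm u + proj_norm v"
proof (rule field_le_epsilon)
  fix e :: real assume "e > 0"
  obtain xs where xs: "u = (\<Sum>(a, b)\<leftarrow>xs. a \<otimes>\<^sub>t b)"
      "(\<Sum>(a, b)\<leftarrow>xs. norm a * norm b) < proj_norm u + e / 2"
    using proj_norm_approx[of u "proj_norm u + e / 2"] \<open>e > 0\<close> by auto
  obtain ys where ys: "v = (\<Sum>(a, b)\<leftarrow>ys. a \<otimes>\<^sub>t b)"
      "(\<Sum>(a, b)\<leftarrow>ys. norm a * norm b) < proj_norm v + e / 2"
    using proj_norm_approx[of v "proj_norm v + e / 2"] \<open>e > 0\<close> by auto
  have "proj_norm (u + v) \<le> (\<Sum>(a, b)\<leftarrow>xs @ ys. norm a * norm b)"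
    by (rule proj_norm_le) (simp add: xs ys)
  then show "proj_norm (u + v) \<le> proj_norm u + proj_norm v + e"
    using xs ys by simp
qed

lemma scaleC_tensor_sum:
  "c *\<^sub>C (\<Sum>(a, b)\<leftarrow>xs. a \<otimes>\<^sub>t b) = (\<Sum>(a, b)\<leftarrow>map (\<lambda>(a, b). (c *\<^sub>C a, b)) xs. a \<otimes>\<^sub>t b)"
  by (induction xs) (auto simp: scaleC_add_right pure_scale_left)

lemma proj_norm_scale_le: "proj_norm (c *\<^sub>C u) \<le> cmod c * proj_norm u"
proof (cases "c = 0")
  case False
  have "proj_norm (c *\<^sub>C u) / cmod c \<le> proj_norm u"
  proof (rule proj_norm_ge)
    fix xs assume u: "u = (\<Sum>(a, b)\<leftarrow>xs. a \<otimes>\<^sub>t b)"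
    have "proj_norm (c *\<^sub>C u) \<le> (\<Sum>(a, b)\<leftarrow>map (\<lambda>(a, b). (c *\<^sub>C a, b)) xs. norm a * norm b)"
      by (rule proj_norm_le) (simp only: u scaleC_tensor_sum)
    also have "\<dots> = cmod c * (\<Sum>(a, b)\<leftarrow>xs. norm a * norm b)"
      by (induction xs) (auto simp: norm_scaleC algebra_simps)
    finally show "proj_norm (c *\<^sub>C u) / cmod c \<le> (\<Sum>(a, b)\<leftarrow>xs. norm a * norm b)"
      using False by (simp add: field_simps)
  qed
  then show ?thesis using False by (simp add: field_simps)
qed simp

lemma proj_norm_scale: "proj_norm (c *\<^sub>C u) = cmod c * proj_norm u"
proof (cases "c = 0")
  case False
  have "proj_norm (inverse c *\<^sub>C c *\<^sub>C u) \<le> cmod (inverse c) * proj_norm (c *\<^sub>C u)"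
    by (rule proj_norm_scale_le)
  then have "cmod c * proj_norm u \<le> proj_norm (c *\<^sub>C u)"
    using False by (simp add: scaleC_scaleC scaleC_one norm_inverse flip: divide_inverse_commute)
      (simp add: pos_le_divide_eq mult.commute)
  with proj_norm_scale_le[of c u] show ?thesis by simp
qed simp

lemma proj_norm_minus [simp]: "proj_norm (- u) = proj_norm u"
  using proj_norm_scale[of "-1" u] by simp

lemma proj_norm_minus_commute: "proj_norm (u - v) = proj_norm (v - u)"
  by (metis minus_diff_eq proj_norm_minus)

lemma proj_norm_triangle: "proj_norm (u - w) \<le> proj_norm (u - v) + proj_norm (v - w)"
  using proj_norm_add[of "u - v" "v - w"] by simp

lemma proj_norm_reverse_triangle: "\<bar>proj_norm u - proj_norm v\<bar> \<le> proj_norm (u - v)"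
  using proj_norm_add[of "u - v" v] proj_norm_add[of "v - u" u] proj_norm_minus_commute[of u v]
  by simp

lemma proj_norm_mult: "proj_norm (u * v) \<le> proj_norm u * proj_norm v"
proof -
  have pure: "proj_norm (a \<otimes>\<^sub>t b * v) \<le> norm a * norm b * proj_norm v" for a b
  proof (cases "norm a * norm b = 0")
    case True
    have "0 *\<^sub>C a = a \<or> 0 *\<^sub>C b = b" using True by auto
    then have "a \<otimes>\<^sub>t b = 0 *\<^sub>C (a \<otimes>\<^sub>t b)" by (metis pure_scale_left pure_scale_right)
    then show ?thesis using True by auto
  next
    case False
    then have pos: "norm a * norm b > 0" by (metis mult_nonneg_nonneg norm_ge_zero order_le_less)
    have "proj_norm (a \<otimes>\<^sub>t b * v) / (norm a * norm b) \<le> proj_norm v"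
    proof (rule proj_norm_ge)
      fix ys assume v: "v = (\<Sum>(c, d)\<leftarrow>ys. c \<otimes>\<^sub>t d)"
      have "proj_norm (a \<otimes>\<^sub>t b * v) \<le> (\<Sum>(c, d)\<leftarrow>ys. norm a * norm b * (norm c * norm d))"
        unfolding v
      proof (induction ys)
        case (Cons y ys)
        obtain c d where y: "y = (c, d)" by (cases y)
        have "norm (a * c) * norm (b * d) \<le> (norm a * norm c) * (norm b * norm d)"
          by (intro mult_mono norm_mult_ineq) auto
        then have "proj_norm ((a * c) \<otimes>\<^sub>t (b * d)) \<le> norm a * norm b * (norm c * norm d)"
          using proj_norm_pure_le[of "a * c" "b * d"] by (simp add: ac_simps)
        moreover have "proj_norm (a \<otimes>\<^sub>t b * (\<Sum>(c, d)\<leftarrow>y # ys. c \<otimes>\<^sub>t d)) \<le>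
            proj_norm ((a * c) \<otimes>\<^sub>t (b * d)) + proj_norm (a \<otimes>\<^sub>t b * (\<Sum>(c, d)\<leftarrow>ys. c \<otimes>\<^sub>t d))"
          using proj_norm_add by (simp add: y distrib_left pure_mult)
        ultimately show ?case using Cons by (simp add: y)
      qed simp
      also have "\<dots> = norm a * norm b * (\<Sum>(c, d)\<leftarrow>ys. norm c * norm d)"
        by (induction ys) (auto simp: distrib_left)
      finally show "proj_norm (a \<otimes>\<^sub>t b * v) / (norm a * norm b) \<le> (\<Sum>(c, d)\<leftarrow>ys. norm c * norm d)"
        using pos by (simp add: pos_divide_le_eq mult.commute)
    qed
    then show ?thesis using pos by (simp add: pos_divide_le_eq mult.commute)
  qed
  have sum: "proj_norm ((\<Sum>(a, b)\<leftarrow>xs. a \<otimes>\<^sub>t b) * v) \<le> (\<Sum>(a, b)\<leftarrow>xs. norm a * norm b) * proj_norm v" for xs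
  proof (induction xs)
    case (Cons x xs)
    obtain a b where x: "x = (a, b)" by (cases x)
    show ?case
      using Cons pure[of a b] proj_norm_add[of "a \<otimes>\<^sub>t b * v" "(\<Sum>(a, b)\<leftarrow>xs. a \<otimes>\<^sub>t b) * v"]
      by (simp add: x distrib_right)
  qed simp
  show ?thesis
  proof (cases "proj_norm v = 0")
    case True
    obtain xs where "u = (\<Sum>(a, b)\<leftarrow>xs. a \<otimes>\<^sub>t b)" by (rule tensor_sum_of_pure)
    with sum[of xs] True show ?thesis by simp
  next
    case False
    with proj_norm_nonneg[of v] have pos: "proj_norm v > 0" by simp
    have "proj_norm (u * v) / proj_norm v \<le> proj_norm u"
      by (rule proj_norm_ge) (use sum pos in \<open>simp add: pos_divide_le_eq\<close>)
    then show ?thesis using pos by (simp add: pos_divide_le_eq)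
  qed
qed

lemma sum_list_mult_unique:
  fixes xs ys :: "('a::complex_comm_algebra_1 \<times> 'a) list"
  assumes "(\<Sum>(a, b)\<leftarrow>xs. a \<otimes>\<^sub>t b) = (\<Sum>(a, b)\<leftarrow>ys. a \<otimes>\<^sub>t b)"
  shows "(\<Sum>(a, b)\<leftarrow>xs. a * b) = (\<Sum>(a, b)\<leftarrow>ys. a * b)"
proof (rule ccontr)
  assume "\<not> ?thesis"
  then have "(\<Sum>(a, b)\<leftarrow>xs. a * b) - (\<Sum>(a, b)\<leftarrow>ys. a * b) \<noteq> 0" by simp
  then obtain f where f: "clinear f" "f ((\<Sum>(a, b)\<leftarrow>xs. a * b) - (\<Sum>(a, b)\<leftarrow>ys. a * b)) \<noteq> 0"
    by (rule clinear_separates)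
  have add: "f (x + y) = f x + f y" and scale: "f (c *\<^sub>C x) = c * f x" for x y c
    using f(1) by (auto simp: clinear_def)
  have f0: "f 0 = 0" using add[of 0 0] by simp
  have minus: "f (x - y) = f x - f y" for x y using add[of "x - y" y] by simp
  have bil: "cbilinear (\<lambda>a b. f (a * b))"
    by (simp add: cbilinear_def clinear_def add scale distrib_left distrib_right mult_scaleC_left mult_scaleC_right)
  have "f (\<Sum>(a, b)\<leftarrow>zs. a * b) = form_eval zs (\<lambda>a b. f (a * b))" for zs
    by (induction zs) (auto simp: form_eval_def bil add f0)
  moreover have "form_eval xs = form_eval ys"
    using assms by (metis Rep_tensor_sum)
  ultimately show False using f(2) minus by simp
qed

lemma proj_norm_one_pos: "0 < proj_norm (1 :: 'a::complex_comm_banach_algebra_1 tensor)"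
proof -
  have "norm (1 :: 'a) \<le> proj_norm (1 :: 'a tensor)"
  proof (rule proj_norm_ge)
    fix xs :: "('a \<times> 'a) list"
    assume "1 = (\<Sum>(a, b)\<leftarrow>xs. a \<otimes>\<^sub>t b)"
    then have "(\<Sum>(a, b)\<leftarrow>[(1, 1)]. a \<otimes>\<^sub>t b) = (\<Sum>(a, b)\<leftarrow>xs. a \<otimes>\<^sub>t b)" by (simp add: one_tensor)
    from sum_list_mult_unique[OF this] have "norm (1 :: 'a) = norm (\<Sum>(a, b)\<leftarrow>xs. a * b)" by simp
    also have "\<dots> \<le> (\<Sum>(a, b)\<leftarrow>xs. norm a * norm b)"
    proof (induction xs)
      case (Cons x xs)
      then show ?case
        using norm_triangle_ineq[of "fst x * snd x" "\<Sum>(a, b)\<leftarrow>xs. a * b"]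
          norm_mult_ineq[of "fst x" "snd x"]
        by (simp add: split_def)
    qed simp
    finally show "norm (1 :: 'a) \<le> (\<Sum>(a, b)\<leftarrow>xs. norm a * norm b)" .
  qed
  moreover have "0 < norm (1 :: 'a)" by simp
  ultimately show ?thesis by linarith
qed

section \<open>The projective tensor product as the completion\<close>

text \<open>
  Cauchy sequences for \<open>proj_norm\<close> modulo null sequences. That \<open>proj_norm\<close> is definite, so that
  \<open>of_tensor\<close> is an embedding, is a consequence of the Hahn-Banach theorem and is not needed here.
\<close>

definition proj_Cauchy :: "(nat \<Rightarrow> 'a::complex_comm_banach_algebra_1 tensor) \<Rightarrow> bool" where
  "proj_Cauchy X \<longleftrightarrow> (\<forall>e>0. \<exists>N. \<forall>m\<ge>N. \<forall>n\<ge>N. proj_norm (X m - X n) < e)"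

definition proj_rel ::
  "(nat \<Rightarrow> 'a::complex_comm_banach_algebra_1 tensor) \<Rightarrow> (nat \<Rightarrow> 'a tensor) \<Rightarrow> bool" where
  "proj_rel X Y \<longleftrightarrow> proj_Cauchy X \<and> proj_Cauchy Y \<and> (\<lambda>n. proj_norm (X n - Y n)) \<longlonglongrightarrow> 0"

lemma proj_Cauchy_const: "proj_Cauchy (\<lambda>_. u)"
  by (simp add: proj_Cauchy_def)

lemma proj_rel_refl [simp]: "proj_rel X X \<longleftrightarrow> proj_Cauchy X"
  by (simp add: proj_rel_def)

lemma null_le:
  fixes f g :: "nat \<Rightarrow> real"
  assumes "g \<longlonglongrightarrow> 0" "\<And>n. 0 \<le> f n" "\<And>n. f n \<le> g n"
  shows "f \<longlonglongrightarrow> 0"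
  by (rule tendsto_sandwich[of "\<lambda>_. 0" f _ g]) (use assms in auto)

lemma part_equivp_proj_rel:
  "part_equivp (proj_rel :: (nat \<Rightarrow> 'a::complex_comm_banach_algebra_1 tensor) \<Rightarrow> _)"
proof (rule part_equivpI)
  show "\<exists>X :: nat \<Rightarrow> 'a tensor. proj_rel X X" using proj_Cauchy_const by auto
  show "symp (proj_rel :: (nat \<Rightarrow> 'a tensor) \<Rightarrow> _)"
  proof (rule sympI)
    fix X Y :: "nat \<Rightarrow> 'a tensor"
    assume "proj_rel X Y"
    moreover have "proj_norm (Y n - X n) = proj_norm (X n - Y n)" for n
      by (rule proj_norm_minus_commute)
    ultimately show "proj_rel Y X" unfolding proj_rel_def by presburger
  qed
  show "transp (proj_rel :: (nat \<Rightarrow> 'a tensor) \<Rightarrow> _)"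
  proof (rule transpI)
    fix X Y Z :: "nat \<Rightarrow> 'a tensor"
    assume *: "proj_rel X Y" "proj_rel Y Z"
    have "(\<lambda>n. proj_norm (X n - Y n) + proj_norm (Y n - Z n)) \<longlonglongrightarrow> 0"
      using * tendsto_add_zero by (auto simp: proj_rel_def)
    then have "(\<lambda>n. proj_norm (X n - Z n)) \<longlonglongrightarrow> 0"
      by (rule null_le) (simp_all add: proj_norm_nonneg proj_norm_triangle)
    with * show "proj_rel X Z" by (simp add: proj_rel_def)
  qed
qed

quotient_type (overloaded) 'a ptensor =
  "nat \<Rightarrow> 'a::complex_comm_banach_algebra_1 tensor" / partial: proj_rel
  by (rule part_equivp_proj_rel)

lemma proj_norm_convergent:
  assumes "proj_Cauchy X"
  shows "convergent (\<lambda>n. proj_norm (X n))"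
proof (rule Cauchy_convergent, rule metric_CauchyI)
  fix e :: real assume "e > 0"
  then obtain N where "\<forall>m\<ge>N. \<forall>n\<ge>N. proj_norm (X m - X n) < e"
    using assms unfolding proj_Cauchy_def by blast
  then have N: "proj_norm (X m - X n) < e" if "m \<ge> N" "n \<ge> N" for m n
    using that by blast
  have "dist (proj_norm (X m)) (proj_norm (X n)) < e" if "m \<ge> N" "n \<ge> N" for m n
    using N[OF that] proj_norm_reverse_triangle[of "X m" "X n"] by (simp add: dist_real_def)
  then show "\<exists>M. \<forall>m\<ge>M. \<forall>n\<ge>M. dist (proj_norm (X m)) (proj_norm (X n)) < e" by blast
qed

lemma proj_Cauchy_bounded:
  assumes "proj_Cauchy X"
  obtains K where "K > 0" "\<And>n. proj_norm (X n) \<le> K"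
proof -
  have "Bseq (\<lambda>n. proj_norm (X n))"
    by (rule convergent_imp_Bseq[OF proj_norm_convergent[OF assms]])
  then obtain K where "K > 0" "\<And>n. norm (proj_norm (X n)) \<le> K" by (rule BseqE) blast
  then show thesis by (intro that[of K]) (auto simp: proj_norm_nonneg)
qed

lemma proj_Cauchy_add:
  assumes "proj_Cauchy X" "proj_Cauchy Y"
  shows "proj_Cauchy (\<lambda>n. X n + Y n)"
  unfolding proj_Cauchy_def
proof (intro allI impI)
  fix e :: real assume "e > 0"
  then have "e / 2 > 0" by simp
  with assms obtain N M where
    N: "\<And>m n. m \<ge> N \<Longrightarrow> n \<ge> N \<Longrightarrow> proj_norm (X m - X n) < e / 2" and
    M: "\<And>m n. m \<ge> M \<Longrightarrow> n \<ge> M \<Longrightarrow> proj_norm (Y m - Y n) < e / 2"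
    unfolding proj_Cauchy_def by meson
  have "proj_norm (X m + Y m - (X n + Y n)) < e" if "m \<ge> max N M" "n \<ge> max N M" for m n
    using N[of m n] M[of m n] that proj_norm_add[of "X m - X n" "Y m - Y n"]
    by (simp add: add_diff_add)
  then show "\<exists>N. \<forall>m\<ge>N. \<forall>n\<ge>N. proj_norm (X m + Y m - (X n + Y n)) < e" by blast
qed

lemma proj_mult_diff:
  "proj_norm (u * v - u' * v') \<le> proj_norm u * proj_norm (v - v') + proj_norm (u - u') * proj_norm v'"
proof -
  have "u * v - u' * v' = u * (v - v') + (u - u') * v'" by (simp add: algebra_simps)
  then show ?thesis
    using proj_norm_add[of "u * (v - v')" "(u - u') * v'"]
      proj_norm_mult[of u "v - v'"] proj_norm_mult[of "u - u'" v'] by simp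
qed

lemma proj_Cauchy_mult:
  assumes "proj_Cauchy X" "proj_Cauchy Y"
  shows "proj_Cauchy (\<lambda>n. X n * Y n)"
  unfolding proj_Cauchy_def
proof (intro allI impI)
  fix e :: real assume "e > 0"
  obtain K where K: "K > 0" "\<And>n. proj_norm (X n) \<le> K"
    using proj_Cauchy_bounded[OF assms(1)] by blast
  obtain L where L: "L > 0" "\<And>n. proj_norm (Y n) \<le> L"
    using proj_Cauchy_bounded[OF assms(2)] by blast
  have "e / (2 * L) > 0" "e / (2 * K) > 0" using \<open>e > 0\<close> K L by simp_all
  with assms obtain N M where
    N: "\<And>m n. m \<ge> N \<Longrightarrow> n \<ge> N \<Longrightarrow> proj_norm (X m - X n) < e / (2 * L)" and
    M: "\<And>m n. m \<ge> M \<Longrightarrow> n \<ge> M \<Longrightarrow> proj_norm (Y m - Y n) < e / (2 * K)"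
    unfolding proj_Cauchy_def by meson
  have "proj_norm (X m * Y m - X n * Y n) < e" if "m \<ge> max N M" "n \<ge> max N M" for m n
  proof -
    have "proj_norm (X m * Y m - X n * Y n) \<le>
        proj_norm (X m) * proj_norm (Y m - Y n) + proj_norm (X m - X n) * proj_norm (Y n)"
      by (rule proj_mult_diff)
    also have "\<dots> \<le> K * proj_norm (Y m - Y n) + proj_norm (X m - X n) * L"
      by (intro add_mono mult_mono) (use K L in \<open>auto simp: proj_norm_nonneg\<close>)
    also have "\<dots> < K * (e / (2 * K)) + (e / (2 * L)) * L"
      by (intro add_strict_mono mult_strict_left_mono mult_strict_right_mono) (use K L N M that in auto)
    also have "\<dots> = e" using K L by (simp add: field_simps)
    finally show ?thesis .
  qed
  then show "\<exists>N. \<forall>m\<ge>N. \<forall>n\<ge>N. proj_norm (X m * Y m - X n * Y n) < e" by blast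
qed

lemma proj_Cauchy_scale:
  assumes "proj_Cauchy X"
  shows "proj_Cauchy (\<lambda>n. c *\<^sub>C X n)"
proof -
  have "proj_Cauchy (\<lambda>n. (c *\<^sub>C 1) * X n)"
    by (rule proj_Cauchy_mult[OF proj_Cauchy_const assms])
  then show ?thesis by (simp add: mult_scaleC_left)
qed

lemma proj_Cauchy_minus: "proj_Cauchy X \<Longrightarrow> proj_Cauchy (\<lambda>n. - X n)"
  using proj_Cauchy_scale[of X "-1"] by simp

lemma proj_Cauchy_diff: "proj_Cauchy X \<Longrightarrow> proj_Cauchy Y \<Longrightarrow> proj_Cauchy (\<lambda>n. X n - Y n)"
  using proj_Cauchy_add[of X "\<lambda>n. - Y n"] proj_Cauchy_minus[of Y] by simp

lemma proj_rel_add: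
  assumes "proj_rel X X'" "proj_rel Y Y'"
  shows "proj_rel (\<lambda>n. X n + Y n) (\<lambda>n. X' n + Y' n)"
proof -
  have "(\<lambda>n. proj_norm (X n - X' n) + proj_norm (Y n - Y' n)) \<longlonglongrightarrow> 0"
    using assms tendsto_add_zero by (auto simp: proj_rel_def)
  then have "(\<lambda>n. proj_norm (X n + Y n - (X' n + Y' n))) \<longlonglongrightarrow> 0"
    by (rule null_le) (simp_all add: proj_norm_nonneg proj_norm_add add_diff_add)
  with assms show ?thesis by (simp add: proj_rel_def proj_Cauchy_add)
qed

lemma proj_rel_mult:
  assumes "proj_rel X X'" "proj_rel Y Y'"
  shows "proj_rel (\<lambda>n. X n * Y n) (\<lambda>n. X' n * Y' n)"
proof -
  have C: "proj_Cauchy X" "proj_Cauchy Y'" using assms by (auto simp: proj_rel_def)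
  obtain K where K: "\<And>n. proj_norm (X n) \<le> K" using proj_Cauchy_bounded[OF C(1)] by blast
  obtain L where L: "\<And>n. proj_norm (Y' n) \<le> L" using proj_Cauchy_bounded[OF C(2)] by blast
  have "(\<lambda>n. K * proj_norm (Y n - Y' n) + proj_norm (X n - X' n) * L) \<longlonglongrightarrow> 0"
    using assms
    by (auto simp: proj_rel_def intro!: tendsto_add_zero tendsto_mult_right_zero tendsto_mult_left_zero)
  then have "(\<lambda>n. proj_norm (X n * Y n - X' n * Y' n)) \<longlonglongrightarrow> 0"
  proof (rule null_le)
    fix n
    have "proj_norm (X n) * proj_norm (Y n - Y' n) + proj_norm (X n - X' n) * proj_norm (Y' n)
        \<le> K * proj_norm (Y n - Y' n) + proj_norm (X n - X' n) * L"
      by (intro add_mono mult_right_mono mult_left_mono K L proj_norm_nonneg)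
    then show "proj_norm (X n * Y n - X' n * Y' n)
        \<le> K * proj_norm (Y n - Y' n) + proj_norm (X n - X' n) * L"
      using proj_mult_diff[of "X n" "Y n" "X' n" "Y' n"] by linarith
  qed (rule proj_norm_nonneg)
  with assms show ?thesis by (simp add: proj_rel_def proj_Cauchy_mult)
qed

lemma proj_rel_scale:
  assumes "proj_rel X X'"
  shows "proj_rel (\<lambda>n. c *\<^sub>C X n) (\<lambda>n. c *\<^sub>C X' n)"
  using proj_rel_mult[of "\<lambda>_. c *\<^sub>C 1" "\<lambda>_. c *\<^sub>C 1" X X'] assms
  by (simp add: mult_scaleC_left proj_Cauchy_const)

lemma proj_rel_minus: "proj_rel X X' \<Longrightarrow> proj_rel (\<lambda>n. - X n) (\<lambda>n. - X' n)"
  using proj_rel_scale[of X X' "-1"] by simp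

lemma proj_rel_diff:
  "proj_rel X X' \<Longrightarrow> proj_rel Y Y' \<Longrightarrow> proj_rel (\<lambda>n. X n - Y n) (\<lambda>n. X' n - Y' n)"
  using proj_rel_add[of X X' "\<lambda>n. - Y n" "\<lambda>n. - Y' n"] proj_rel_minus[of Y Y'] by simp

lemma proj_rel_lim:
  assumes "proj_rel X Y"
  shows "lim (\<lambda>n. proj_norm (X n)) = lim (\<lambda>n. proj_norm (Y n))"
proof -
  have X: "(\<lambda>n. proj_norm (X n)) \<longlonglongrightarrow> lim (\<lambda>n. proj_norm (X n))"
    using assms proj_norm_convergent by (auto simp: proj_rel_def convergent_LIMSEQ_iff)
  have "(\<lambda>n. proj_norm (Y n) - proj_norm (X n)) \<longlonglongrightarrow> 0"
  proof (rule Lim_null_comparison)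
    show "\<forall>\<^sub>F n in sequentially. norm (proj_norm (Y n) - proj_norm (X n)) \<le> proj_norm (X n - Y n)"
      using proj_norm_reverse_triangle[of "X n" "Y n" for n]
      by (simp add: abs_minus_commute)
  qed (use assms in \<open>simp add: proj_rel_def\<close>)
  from tendsto_add[OF this X] have "(\<lambda>n. proj_norm (Y n)) \<longlonglongrightarrow> lim (\<lambda>n. proj_norm (X n))" by simp
  then show ?thesis by (simp add: limI)
qed

lemma proj_Cauchy_LIMSEQ:
  "proj_Cauchy X \<Longrightarrow> (\<lambda>n. proj_norm (X n)) \<longlonglongrightarrow> lim (\<lambda>n. proj_norm (X n))"
  using proj_norm_convergent by (auto simp: convergent_LIMSEQ_iff)

lift_definition of_tensor :: "'a::complex_comm_banach_algebra_1 tensor \<Rightarrow> 'a ptensor" is "\<lambda>u _. u"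
  by (simp add: proj_Cauchy_const)

instantiation ptensor :: (complex_comm_banach_algebra_1) complex_comm_algebra_1
begin

lift_definition zero_ptensor :: "'a ptensor" is "\<lambda>_. 0" by (simp add: proj_Cauchy_const)

lift_definition one_ptensor :: "'a ptensor" is "\<lambda>_. 1" by (simp add: proj_Cauchy_const)

lift_definition plus_ptensor :: "'a ptensor \<Rightarrow> 'a ptensor \<Rightarrow> 'a ptensor" is "\<lambda>X Y n. X n + Y n"
  by (rule proj_rel_add)

lift_definition minus_ptensor :: "'a ptensor \<Rightarrow> 'a ptensor \<Rightarrow> 'a ptensor" is "\<lambda>X Y n. X n - Y n"
  by (rule proj_rel_diff)

lift_definition uminus_ptensor :: "'a ptensor \<Rightarrow> 'a ptensor" is "\<lambda>X n. - X n"
  by (rule proj_rel_minus)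

lift_definition times_ptensor :: "'a ptensor \<Rightarrow> 'a ptensor \<Rightarrow> 'a ptensor" is "\<lambda>X Y n. X n * Y n"
  by (rule proj_rel_mult)

lift_definition scaleC_ptensor :: "complex \<Rightarrow> 'a ptensor \<Rightarrow> 'a ptensor" is "\<lambda>c X n. c *\<^sub>C X n"
  by (rule proj_rel_scale)

instance
proof
  fix u v w :: "'a ptensor" and c d :: complex
  note C = proj_Cauchy_add proj_Cauchy_diff proj_Cauchy_minus proj_Cauchy_mult proj_Cauchy_scale
    proj_Cauchy_const
  show "u * v * w = u * (v * w)" by transfer (simp add: mult.assoc C)
  show "u * v = v * u" by transfer (simp add: mult.commute C)
  show "1 * u = u" by transfer simp
  show "(u + v) * w = u * w + v * w" by transfer (simp add: distrib_right C)
  show "u + v + w = u + (v + w)" by transfer (simp add: add.assoc C)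
  show "u + v = v + u" by transfer (simp add: add.commute C)
  show "0 + u = u" by transfer simp
  show "- u + u = 0" by transfer (simp add: C)
  show "u - v = u + - v" by transfer (simp add: C)
  show "(0 :: 'a ptensor) \<noteq> 1"
  proof transfer
    have "\<not> (\<lambda>_::nat. proj_norm (0 - 1 :: 'a tensor)) \<longlonglongrightarrow> 0"
      using proj_norm_one_pos[where 'a='a] by (auto simp: LIMSEQ_const_iff)
    then show "\<not> proj_rel (\<lambda>_. 0) (\<lambda>_. 1 :: 'a tensor)" by (simp add: proj_rel_def)
  qed
  show "c *\<^sub>C (u + v) = c *\<^sub>C u + c *\<^sub>C v" by transfer (simp add: scaleC_add_right C)
  show "(c + d) *\<^sub>C u = c *\<^sub>C u + d *\<^sub>C u" by transfer (simp add: scaleC_add_left C)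
  show "c *\<^sub>C d *\<^sub>C u = (c * d) *\<^sub>C u" by transfer (simp add: scaleC_scaleC C)
  show "1 *\<^sub>C u = u" by transfer (simp add: scaleC_one)
  show "c *\<^sub>C u * v = c *\<^sub>C (u * v)" by transfer (simp add: mult_scaleC_left C)
qed

end

instantiation ptensor :: (complex_comm_banach_algebra_1) real_algebra
begin

definition scaleR_ptensor :: "real \<Rightarrow> 'a ptensor \<Rightarrow> 'a ptensor" where
  "scaleR_ptensor r x = complex_of_real r *\<^sub>C x"

instance
proof
  fix x y :: "'a ptensor" and r s :: real
  show "r *\<^sub>R (x + y) = r *\<^sub>R x + r *\<^sub>R y" by (simp add: scaleR_ptensor_def scaleC_add_right)
  show "(r + s) *\<^sub>R x = r *\<^sub>R x + s *\<^sub>R x" by (simp add: scaleR_ptensor_def scaleC_add_left)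
  show "r *\<^sub>R s *\<^sub>R x = (r * s) *\<^sub>R x" by (simp add: scaleR_ptensor_def scaleC_scaleC)
  show "1 *\<^sub>R x = x" by (simp add: scaleR_ptensor_def scaleC_one)
  show "r *\<^sub>R x * y = r *\<^sub>R (x * y)" by (simp add: scaleR_ptensor_def mult_scaleC_left)
  show "x * r *\<^sub>R y = r *\<^sub>R (x * y)" by (simp add: scaleR_ptensor_def mult_scaleC_right)
qed

end

instantiation ptensor :: (complex_comm_banach_algebra_1) real_normed_algebra
begin

lift_definition norm_ptensor :: "'a ptensor \<Rightarrow> real" is "\<lambda>X. lim (\<lambda>n. proj_norm (X n))"
  by (rule proj_rel_lim)

definition dist_ptensor :: "'a ptensor \<Rightarrow> 'a ptensor \<Rightarrow> real" where
  "dist_ptensor x y = norm (x - y)"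

definition sgn_ptensor :: "'a ptensor \<Rightarrow> 'a ptensor" where
  "sgn_ptensor x = x /\<^sub>R norm x"

definition uniformity_ptensor :: "('a ptensor \<times> 'a ptensor) filter" where
  "uniformity_ptensor = (INF e\<in>{0 <..}. principal {(x, y). dist x y < e})"

definition open_ptensor :: "'a ptensor set \<Rightarrow> bool" where
  "open_ptensor U \<longleftrightarrow> (\<forall>x\<in>U. \<forall>\<^sub>F (x', y) in uniformity. x' = x \<longrightarrow> y \<in> U)"

lemma norm_scaleC_ptensor:
  "norm (c *\<^sub>C x) = cmod c * norm (x :: 'a ptensor)"
proof transfer
  fix c and X :: "nat \<Rightarrow> 'a tensor" assume "proj_rel X X"
  then have "(\<lambda>n. cmod c * proj_norm (X n)) \<longlonglongrightarrow> cmod c * lim (\<lambda>n. proj_norm (X n))"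
    by (intro tendsto_mult_left proj_Cauchy_LIMSEQ) simp
  then show "lim (\<lambda>n. proj_norm (c *\<^sub>C X n)) = cmod c * lim (\<lambda>n. proj_norm (X n))"
    by (simp add: proj_norm_scale limI)
qed

instance
proof
  fix x y :: "'a ptensor" and r :: real
  show "sgn x = x /\<^sub>R norm x" by (rule sgn_ptensor_def)
  show "dist x y = norm (x - y)" by (rule dist_ptensor_def)
  show "(uniformity :: ('a ptensor \<times> 'a ptensor) filter) =
      (INF e\<in>{0 <..}. principal {(x, y). dist x y < e})" by (rule uniformity_ptensor_def)
  show "open U \<longleftrightarrow> (\<forall>x\<in>U. \<forall>\<^sub>F (x', y) in uniformity. x' = x \<longrightarrow> y \<in> U)" for U :: "'a ptensor set"
    by (rule open_ptensor_def)
  show "norm (r *\<^sub>R x) = \<bar>r\<bar> * norm x"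
    unfolding scaleR_ptensor_def norm_scaleC_ptensor norm_of_real ..
  show "norm x = 0 \<longleftrightarrow> x = 0"
  proof transfer
    fix X :: "nat \<Rightarrow> 'a tensor" assume "proj_rel X X"
    then have C: "proj_Cauchy X" by simp
    then have "proj_rel X (\<lambda>_. 0) \<longleftrightarrow> (\<lambda>n. proj_norm (X n)) \<longlonglongrightarrow> 0"
      by (simp add: proj_rel_def proj_Cauchy_const)
    also have "\<dots> \<longleftrightarrow> lim (\<lambda>n. proj_norm (X n)) = 0"
      using proj_Cauchy_LIMSEQ[OF C] limI by metis
    finally show "lim (\<lambda>n. proj_norm (X n)) = 0 \<longleftrightarrow> proj_rel X (\<lambda>_. 0)" ..
  qed
  show "norm (x + y) \<le> norm x + norm y"
  proof transfer
    fix X Y :: "nat \<Rightarrow> 'a tensor" assume "proj_rel X X" "proj_rel Y Y"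
    then have "proj_Cauchy X" "proj_Cauchy Y" by simp_all
    then show "lim (\<lambda>n. proj_norm (X n + Y n)) \<le> lim (\<lambda>n. proj_norm (X n)) + lim (\<lambda>n. proj_norm (Y n))"
      by (intro LIMSEQ_le[OF proj_Cauchy_LIMSEQ[OF proj_Cauchy_add]
            tendsto_add[OF proj_Cauchy_LIMSEQ proj_Cauchy_LIMSEQ]])
        (auto simp: proj_norm_add)
  qed
  show "norm (x * y) \<le> norm x * norm y"
  proof transfer
    fix X Y :: "nat \<Rightarrow> 'a tensor" assume "proj_rel X X" "proj_rel Y Y"
    then have "proj_Cauchy X" "proj_Cauchy Y" by simp_all
    then show "lim (\<lambda>n. proj_norm (X n * Y n)) \<le> lim (\<lambda>n. proj_norm (X n)) * lim (\<lambda>n. proj_norm (Y n))"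
      by (intro LIMSEQ_le[OF proj_Cauchy_LIMSEQ[OF proj_Cauchy_mult]
            tendsto_mult[OF proj_Cauchy_LIMSEQ proj_Cauchy_LIMSEQ]])
        (auto simp: proj_norm_mult)
  qed
qed

end

lemma norm_of_tensor: "norm (of_tensor u) = proj_norm u"
  by transfer (simp add: limI)

lemma of_tensor_zero: "of_tensor 0 = 0"
  by transfer (simp add: proj_Cauchy_const)

lemma of_tensor_one: "of_tensor 1 = 1"
  by transfer (simp add: proj_Cauchy_const)

lemma of_tensor_add: "of_tensor (u + v) = of_tensor u + of_tensor v"
  by transfer (simp add: proj_Cauchy_const)

lemma of_tensor_diff: "of_tensor (u - v) = of_tensor u - of_tensor v"
  by transfer (simp add: proj_Cauchy_const)

lemma of_tensor_mult: "of_tensor (u * v) = of_tensor u * of_tensor v"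
  by transfer (simp add: proj_Cauchy_const)

lemma of_tensor_scaleC: "of_tensor (c *\<^sub>C u) = c *\<^sub>C of_tensor u"
  by transfer (simp add: proj_Cauchy_const)

lemma of_tensor_LIMSEQ:
  assumes "proj_Cauchy X"
  shows "(\<lambda>n. of_tensor (X n)) \<longlonglongrightarrow> abs_ptensor X"
proof (rule metric_LIMSEQ_I)
  fix e :: real assume "e > 0"
  then have "e / 2 > 0" by simp
  then obtain N where N: "\<And>m n. m \<ge> N \<Longrightarrow> n \<ge> N \<Longrightarrow> proj_norm (X m - X n) < e / 2"
    using assms unfolding proj_Cauchy_def by meson
  have "dist (of_tensor (X m)) (abs_ptensor X) < e" if m: "m \<ge> N" for m
  proof -
    have C: "proj_Cauchy (\<lambda>n. X m - X n)"
      by (rule proj_Cauchy_diff[OF proj_Cauchy_const assms])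
    have "dist (of_tensor (X m)) (abs_ptensor X) = lim (\<lambda>n. proj_norm (X m - X n))"
      using assms C
      by (simp add: dist_ptensor_def of_tensor.abs_eq minus_ptensor.abs_eq norm_ptensor.abs_eq
          proj_Cauchy_const)
    also have "\<dots> \<le> e / 2"
      by (rule LIMSEQ_le_const2[OF proj_Cauchy_LIMSEQ[OF C]]) (use N m in \<open>auto intro: less_imp_le\<close>)
    finally show ?thesis using \<open>e > 0\<close> by simp
  qed
  then show "\<exists>N. \<forall>n\<ge>N. dist (of_tensor (X n)) (abs_ptensor X) < e" by blast
qed

lemma ptensor_abs_cases:
  obtains X where "proj_Cauchy X" "x = abs_ptensor X"
proof -
  have "\<exists>X. proj_Cauchy X \<and> x = abs_ptensor X"
  proof (induction x rule: ptensor.abs_induct)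
    case (1 Y)
    then show ?case by (intro exI[of _ Y]) simp
  qed
  then show thesis using that by blast
qed

lemma of_tensor_dense:
  assumes "e > 0"
  shows "\<exists>u. dist x (of_tensor u) < e"
proof -
  obtain X where X: "proj_Cauchy X" "x = abs_ptensor X" by (rule ptensor_abs_cases)
  obtain N where "\<forall>n\<ge>N. dist (of_tensor (X n)) (abs_ptensor X) < e"
    using metric_LIMSEQ_D[OF of_tensor_LIMSEQ[OF X(1)] assms] by blast
  then have "dist x (of_tensor (X N)) < e" by (simp add: X(2) dist_commute)
  then show ?thesis by blast
qed

instance ptensor :: (complex_comm_banach_algebra_1) complex_comm_banach_algebra_1
proof
  fix Y :: "nat \<Rightarrow> 'a ptensor" assume Y: "Cauchy Y"
  have "\<exists>u. dist (Y n) (of_tensor u) < inverse (real (Suc n))" for n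
    by (rule of_tensor_dense) simp
  then obtain u where u: "\<And>n. dist (Y n) (of_tensor (u n)) < inverse (real (Suc n))" by metis
  have d0: "(\<lambda>n. dist (Y n) (of_tensor (u n))) \<longlonglongrightarrow> 0"
  proof (rule null_le)
    show "dist (Y n) (of_tensor (u n)) \<le> inverse (real (Suc n))" for n
      using u[of n] by (rule less_imp_le)
  qed (rule LIMSEQ_inverse_real_of_nat zero_le_dist)+
  have "proj_Cauchy u"
    unfolding proj_Cauchy_def
  proof (intro allI impI)
    fix e :: real assume "e > 0"
    then have e: "e / 3 > 0" by simp
    obtain N where N: "\<And>m n. m \<ge> N \<Longrightarrow> n \<ge> N \<Longrightarrow> dist (Y m) (Y n) < e / 3"
      using metric_CauchyD[OF Y e] by blast
    obtain M where M: "\<And>n. n \<ge> M \<Longrightarrow> dist (Y n) (of_tensor (u n)) < e / 3"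
      using metric_LIMSEQ_D[OF d0 e] by auto
    have "proj_norm (u m - u n) < e" if "m \<ge> max N M" "n \<ge> max N M" for m n
    proof -
      have "proj_norm (u m - u n) = dist (of_tensor (u m)) (of_tensor (u n))"
        by (simp add: dist_ptensor_def norm_of_tensor flip: of_tensor_diff)
      also have "\<dots> \<le> dist (Y m) (of_tensor (u m)) + dist (Y m) (Y n) + dist (Y n) (of_tensor (u n))"
        using dist_triangle[of "of_tensor (u m)" "of_tensor (u n)" "Y m"]
          dist_triangle[of "Y m" "of_tensor (u n)" "Y n"] by (simp add: dist_commute)
      also have "\<dots> < e" using N[of m n] M[of m] M[of n] that by simp
      finally show ?thesis .
    qed
    then show "\<exists>N. \<forall>m\<ge>N. \<forall>n\<ge>N. proj_norm (u m - u n) < e" by blast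
  qed
  then have lim: "(\<lambda>n. of_tensor (u n)) \<longlonglongrightarrow> abs_ptensor u" by (rule of_tensor_LIMSEQ)
  have "(\<lambda>n. Y n - of_tensor (u n)) \<longlonglongrightarrow> 0"
    using d0 unfolding dist_ptensor_def by (rule tendsto_norm_zero_cancel)
  from tendsto_add[OF this lim] have "Y \<longlonglongrightarrow> abs_ptensor u" by simp
  then show "convergent Y" by (rule convergentI)
qed (simp_all add: scaleR_ptensor_def norm_scaleC_ptensor)

section \<open>Characters, regularity and spectral synthesis\<close>

text \<open>
  Characters are automatically continuous. The topology of \<open>'b \<Rightarrow> complex\<close> is that of pointwise
  convergence, so the subspace topology on \<open>char_space\<close> is the Gelfand topology.
\<close>

definition char_space :: "('b::complex_comm_banach_algebra_1 \<Rightarrow> complex) set" where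
  "char_space = {\<phi>. clinear \<phi> \<and> (\<forall>x y. \<phi> (x * y) = \<phi> x * \<phi> y) \<and> \<phi> \<noteq> (\<lambda>_. 0)}"

definition regular_algebra :: "'b::complex_comm_banach_algebra_1 itself \<Rightarrow> bool" where
  "regular_algebra _ \<longleftrightarrow>
    (\<forall>E x. closedin (top_of_set char_space) E \<and> x \<in> char_space - E \<longrightarrow>
      (\<exists>a::'b. (\<forall>y\<in>E. y a = 0) \<and> x a \<noteq> 0))"

definition closed_ideal :: "'b::complex_comm_banach_algebra_1 set \<Rightarrow> bool" where
  "closed_ideal I \<longleftrightarrow> closed I \<and> 0 \<in> I \<and> (\<forall>x\<in>I. \<forall>y\<in>I. x + y \<in> I) \<and> (\<forall>r. \<forall>x\<in>I. r * x \<in> I)"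

definition ideal_hull :: "'b::complex_comm_banach_algebra_1 set \<Rightarrow> ('b \<Rightarrow> complex) set" where
  "ideal_hull I = {\<phi> \<in> char_space. \<forall>a\<in>I. \<phi> a = 0}"

definition spectral_synthesis :: "('b::complex_comm_banach_algebra_1 \<Rightarrow> complex) set \<Rightarrow> bool" where
  "spectral_synthesis E \<longleftrightarrow>
    closedin (top_of_set char_space) E \<and> (\<exists>!I. closed_ideal I \<and> ideal_hull I = E)"

text \<open>
  A pair \<open>(x, y)\<close> of characters of \<open>B\<close> is identified with the character \<open>\<phi>\<close> of the projective
  tensor product given by \<open>\<phi> (a \<otimes> b) = x a * y b\<close>.
\<close>

definition diagonal :: "('a::complex_comm_banach_algebra_1 ptensor \<Rightarrow> complex) set" where
  "diagonal = {\<phi> \<in> char_space. \<exists>x\<in>char_space. \<forall>a b. \<phi> (of_tensor (a \<otimes>\<^sub>t b)) = x a * x b}"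

section \<open>The algebras T_Lie and N_Lie\<close>

definition subalgebra :: "'b::complex_comm_algebra_1 set \<Rightarrow> bool" where
  "subalgebra S \<longleftrightarrow> 0 \<in> S \<and> (\<forall>x\<in>S. \<forall>y\<in>S. x + y \<in> S) \<and> (\<forall>c. \<forall>x\<in>S. c *\<^sub>C x \<in> S) \<and>
    (\<forall>x\<in>S. \<forall>y\<in>S. x * y \<in> S)"

definition T_Lie :: "'a::complex_comm_algebra_1 tensor set" where
  "T_Lie = subalgebra hull (range (\<lambda>a. a \<otimes>\<^sub>t 1 - 1 \<otimes>\<^sub>t a))"

definition N_Lie :: "'a::complex_comm_algebra_1 tensor set" where
  "N_Lie = {\<Sum>(a, b)\<leftarrow>xs. a \<otimes>\<^sub>t b | xs. (\<Sum>(a, b)\<leftarrow>xs. a * b) = 0}"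

end

(*
  Write d(a) = a (x) 1 - 1 (x) a. Although T_Lie is only a subalgebra, it contains the ideal of
  B (x) B generated by the products d(a) d(b): the element d(a) d(b) (c (x) 1) is symmetric in a, b
  and, modulo T_Lie, antisymmetric in b, c, because d(bc) lies in T_Lie; hence twice it lies
  in T_Lie. So the largest ideal K of B (x) B inside T_Lie contains every d(a) d(b). The
  closures of K and of N_Lie are closed ideals, and both have the diagonal as hull, since a
  character killing d(a)^2 kills d(a). As K <= T_Lie <= N_Lie, it remains to see that the closures
  of K and N_Lie coincide, which is spectral synthesis.
*)

theory Submission
  imports Defs
begin

subsection \<open>Continuity of characters\<close>

lemma clinear_zero: "clinear f \<Longrightarrow> f 0 = 0"
  by (metis clinear_def scaleC_zero_left mult_zero_left)

lemma clinear_diff: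
  assumes "clinear f"
  shows "f (x - y) = f x - f y"
proof -
  have "f x = f (x - y + y)" by simp
  also have "\<dots> = f (x - y) + f y" using assms unfolding clinear_def by blast
  finally show ?thesis by simp
qed

lemma char_space_clinear: "\<phi> \<in> char_space \<Longrightarrow> clinear \<phi>"
  by (simp add: char_space_def)

lemma char_space_mult: "\<phi> \<in> char_space \<Longrightarrow> \<phi> (x * y) = \<phi> x * \<phi> y"
  by (simp add: char_space_def)

text \<open>Exponents start at 1 because the unit may have norm above 1, so exponent 0 has to be
  excluded.\<close>

lemma norm_power_Suc_le:
  fixes x :: "'a::{real_normed_algebra,comm_ring_1}"
  shows "norm (x ^ Suc n) \<le> norm x ^ Suc n"
proof (induction n)
  case (Suc n)
  have "norm (x * x ^ Suc n) \<le> norm x * norm (x ^ Suc n)" by (rule norm_mult_ineq)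
  also have "\<dots> \<le> norm x * norm x ^ Suc n" using Suc by (intro mult_left_mono) auto
  finally show ?case by simp
qed simp

text \<open>Neumann series argument: if the bound fails at \<open>x\<close>, rescaling gives
  \<open>y\<close> of norm below 1 with value 1 under the character. The sum \<open>s\<close> of the
  powers of \<open>y\<close> from the first on satisfies \<open>s = y + y * s\<close>, and applying
  the character yields the absurdity \<open>\<phi> s = 1 + \<phi> s\<close>.\<close>

lemma char_space_norm_le:
  fixes \<phi> :: "'b::complex_comm_banach_algebra_1 \<Rightarrow> complex"
  assumes "\<phi> \<in> char_space"
  shows "cmod (\<phi> x) \<le> norm x"
proof (rule ccontr)
  assume "\<not> ?thesis"
  then have less: "norm x < cmod (\<phi> x)" by simp
  then have "cmod (\<phi> x) > 0" using norm_ge_zero[of x] by linarith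
  define y where "y = inverse (\<phi> x) *\<^sub>C x"
  have "\<phi> y = inverse (\<phi> x) * \<phi> x"
    unfolding y_def using char_space_clinear[OF assms] by (simp add: clinear_def)
  then have \<phi>y: "\<phi> y = 1" using \<open>cmod (\<phi> x) > 0\<close> by simp
  have "norm y = norm x / cmod (\<phi> x)"
    unfolding y_def by (simp add: norm_scaleC norm_inverse divide_inverse mult.commute)
  then have "norm y < 1" using less \<open>cmod (\<phi> x) > 0\<close> by simp
  then have "summable (\<lambda>n. norm y ^ Suc n)"
    by (subst summable_Suc_iff) (simp add: summable_geometric)
  then have sm: "summable (\<lambda>n. y ^ Suc n)"
    by (rule summable_comparison_test'[where N = 0]) (rule norm_power_Suc_le)
  define s where "s = (\<Sum>n. y ^ Suc n)"
  have "y * s = (\<Sum>n. y * y ^ Suc n)"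
    unfolding s_def by (rule suminf_mult[OF sm, symmetric])
  also have "\<dots> = s - y"
    unfolding s_def using suminf_split_head[OF sm] by simp
  finally have "s = y + y * s" by simp
  then have "\<phi> s = \<phi> y + \<phi> y * \<phi> s"
    using assms by (metis char_space_clinear char_space_mult clinear_def)
  then show False by (simp add: \<phi>y)
qed

lemma continuous_on_char_space:
  fixes \<phi> :: "'b::complex_comm_banach_algebra_1 \<Rightarrow> complex"
  assumes "\<phi> \<in> char_space"
  shows "continuous_on A \<phi>"
proof (intro lipschitz_on_continuous_on[of 1] lipschitz_onI)
  fix x y
  show "dist (\<phi> x) (\<phi> y) \<le> 1 * dist x y"
    using char_space_norm_le[OF assms, of "x - y"] clinear_diff[OF char_space_clinear[OF assms]]
    by (simp add: dist_norm)
qed simp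

text \<open>Zero sets of characters are closed, so hulls can be computed before taking closures, on
  algebraic tensors only.\<close>

lemma ideal_hull_closure:
  "ideal_hull (closure S) = ideal_hull (S :: 'b::complex_comm_banach_algebra_1 set)"
proof
  show "ideal_hull (closure S) \<subseteq> ideal_hull S"
    using closure_subset[of S] by (auto simp: ideal_hull_def)
  show "ideal_hull S \<subseteq> ideal_hull (closure S)"
  proof
    fix \<phi> assume \<phi>: "\<phi> \<in> ideal_hull S"
    then have "\<phi> ` closure S \<subseteq> {0}"
      by (intro image_closure_subset continuous_on_char_space) (auto simp: ideal_hull_def)
    with \<phi> show "\<phi> \<in> ideal_hull (closure S)" by (auto simp: ideal_hull_def)
  qed
qed

subsection \<open>Ideals of the algebraic tensor product\<close>

text \<open>The purely algebraic part of \<open>closed_ideal\<close>, stated for a type that carries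
  no topology.\<close>

definition tensor_ideal :: "'a::complex_comm_algebra_1 tensor set \<Rightarrow> bool" where
  "tensor_ideal I \<longleftrightarrow> 0 \<in> I \<and> (\<forall>x\<in>I. \<forall>y\<in>I. x + y \<in> I) \<and> (\<forall>r. \<forall>x\<in>I. r * x \<in> I)"

lemma tensor_ideal_subalgebra:
  assumes "tensor_ideal I"
  shows "subalgebra I"
proof -
  have "c *\<^sub>C x \<in> I" if "x \<in> I" for c x
  proof -
    have "(c *\<^sub>C 1) * x \<in> I" using assms that by (simp add: tensor_ideal_def)
    then show ?thesis by (simp add: mult_scaleC_left)
  qed
  then show ?thesis using assms by (simp add: subalgebra_def tensor_ideal_def)
qed

lemma closed_ideal_closure_of_tensor:
  fixes I :: "'a::complex_comm_banach_algebra_1 tensor set"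
  assumes "tensor_ideal I"
  shows "closed_ideal (closure (of_tensor ` I))"
  unfolding closed_ideal_def
proof (intro conjI allI ballI)
  show "0 \<in> closure (of_tensor ` I)"
    using assms of_tensor_zero closure_subset unfolding tensor_ideal_def
    by (metis imageI subsetD)
next
  fix x y assume "x \<in> closure (of_tensor ` I)" "y \<in> closure (of_tensor ` I)"
  then obtain f g where f: "\<And>n. f n \<in> of_tensor ` I" "f \<longlonglongrightarrow> x"
    and g: "\<And>n. g n \<in> of_tensor ` I" "g \<longlonglongrightarrow> y"
    unfolding closure_sequential by blast
  have "f n + g n \<in> of_tensor ` I" for n
    using f(1)[of n] g(1)[of n] assms
    by (auto simp: tensor_ideal_def simp flip: of_tensor_add)
  then show "x + y \<in> closure (of_tensor ` I)"
    unfolding closure_sequential using tendsto_add[OF f(2) g(2)]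
    by (intro exI[of _ "\<lambda>n. f n + g n"]) blast
next
  fix r x :: "'a ptensor"
  \<comment> \<open>The multiplier ranges over the whole completion, so it too is approximated by
    algebraic tensors; the products of the approximants stay in the image of
    \<open>I\<close>.\<close>
  have "r \<in> closure (range of_tensor)"
    unfolding closure_approachable using of_tensor_dense[of _ r] by (auto simp: dist_commute)
  moreover assume "x \<in> closure (of_tensor ` I)"
  ultimately obtain f g where f: "\<And>n. f n \<in> range of_tensor" "f \<longlonglongrightarrow> r"
    and g: "\<And>n. g n \<in> of_tensor ` I" "g \<longlonglongrightarrow> x"
    unfolding closure_sequential by blast
  have "f n * g n \<in> of_tensor ` I" for n
    using f(1)[of n] g(1)[of n] assms
    by (auto simp: tensor_ideal_def simp flip: of_tensor_mult)
  then show "r * x \<in> closure (of_tensor ` I)"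
    unfolding closure_sequential using tendsto_mult[OF f(2) g(2)]
    by (intro exI[of _ "\<lambda>n. f n * g n"]) blast
qed simp

lemma pure_minus_right: "a \<otimes>\<^sub>t (- b) = - (a \<otimes>\<^sub>t b)"
  using pure_scale_right[of a "- 1" b] by simp

lemma pure_diff_in_N_Lie: "a \<otimes>\<^sub>t 1 - 1 \<otimes>\<^sub>t a \<in> N_Lie"
  unfolding N_Lie_def
  by (rule CollectI, rule exI[of _ "[(a, 1), (1, - a)]"]) (simp add: pure_minus_right)

text \<open>\<open>N_Lie\<close> is the kernel of the multiplication map. On representing lists,
  addition is concatenation, and multiplying by a pure tensor of \<open>c\<close> and
  \<open>d\<close> multiplies the sum of products by \<open>c * d\<close>.\<close>

lemma tensor_ideal_N_Lie: "tensor_ideal (N_Lie :: 'a::complex_comm_algebra_1 tensor set)"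
proof -
  have N_add: "x + y \<in> N_Lie" if xy: "x \<in> N_Lie" "y \<in> N_Lie" for x y :: "'a tensor"
  proof -
    obtain xs ys where "x = (\<Sum>(a, b)\<leftarrow>xs. a \<otimes>\<^sub>t b)" "(\<Sum>(a, b)\<leftarrow>xs. a * b) = 0"
      "y = (\<Sum>(a, b)\<leftarrow>ys. a \<otimes>\<^sub>t b)" "(\<Sum>(a, b)\<leftarrow>ys. a * b) = 0"
      using xy unfolding N_Lie_def by blast
    then show ?thesis unfolding N_Lie_def by (intro CollectI exI[of _ "xs @ ys"]) simp
  qed
  have zero: "0 \<in> (N_Lie :: 'a tensor set)"
    unfolding N_Lie_def by (intro CollectI exI[of _ "[]"]) simp
  have "r * x \<in> N_Lie" if x: "x \<in> N_Lie" for r x :: "'a tensor"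
  proof (induction r rule: tensor_induct)
    case zero
    show ?case using \<open>0 \<in> N_Lie\<close> by simp
  next
    case (add c d u)
    obtain xs where xs: "x = (\<Sum>(a, b)\<leftarrow>xs. a \<otimes>\<^sub>t b)" "(\<Sum>(a, b)\<leftarrow>xs. a * b) = 0"
      using x unfolding N_Lie_def by blast
    let ?ys = "map (\<lambda>(a, b). (c * a, d * b)) xs"
    have "c \<otimes>\<^sub>t d * (\<Sum>(a, b)\<leftarrow>xs. a \<otimes>\<^sub>t b) = (\<Sum>(a, b)\<leftarrow>?ys. a \<otimes>\<^sub>t b)"
      by (induction xs) (auto simp: distrib_left pure_mult)
    moreover have "(\<Sum>(a, b)\<leftarrow>?ys. a * b) = (c * d) * (\<Sum>(a, b)\<leftarrow>xs. a * b)"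
      by (induction xs) (auto simp: distrib_left mult_ac)
    ultimately have "c \<otimes>\<^sub>t d * x \<in> N_Lie"
      unfolding N_Lie_def using xs by (intro CollectI exI[of _ ?ys]) simp
    with add.IH show ?case by (simp add: distrib_right N_add)
  qed
  with N_add zero show ?thesis by (simp add: tensor_ideal_def)
qed

lemma subalgebra_T_Lie: "subalgebra (T_Lie :: 'a::complex_comm_algebra_1 tensor set)"
  unfolding T_Lie_def by (rule hull_in) (auto simp: subalgebra_def)

lemma pure_diff_in_T_Lie: "a \<otimes>\<^sub>t 1 - 1 \<otimes>\<^sub>t a \<in> T_Lie"
  unfolding T_Lie_def by (rule hull_inc) blast

lemma T_Lie_subset_N_Lie: "T_Lie \<subseteq> N_Lie"
  unfolding T_Lie_def
  using pure_diff_in_N_Lie tensor_ideal_subalgebra[OF tensor_ideal_N_Lie]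
  by (intro hull_minimal) auto

lemma mult_pure_diff_pure_diff_in_T_Lie:
  fixes v :: "'a::complex_comm_algebra_1 tensor"
  shows "v * ((a \<otimes>\<^sub>t 1 - 1 \<otimes>\<^sub>t a) * (b \<otimes>\<^sub>t 1 - 1 \<otimes>\<^sub>t b)) \<in> T_Lie"
proof -
  define l :: "'a \<Rightarrow> 'a tensor" where "l a = a \<otimes>\<^sub>t 1" for a
  define r :: "'a \<Rightarrow> 'a tensor" where "r a = 1 \<otimes>\<^sub>t a" for a
  define d :: "'a \<Rightarrow> 'a tensor" where "d a = l a - r a" for a
  have l_mult: "l (a * b) = l a * l b" and r_mult: "r (a * b) = r a * r b" for a b
    by (simp_all add: l_def r_def pure_mult)
  have d_T: "d a \<in> T_Lie" for a
    unfolding d_def l_def r_def by (rule pure_diff_in_T_Lie)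
  have T_add: "x + y \<in> T_Lie" and mult: "x * y \<in> T_Lie" and scale: "c *\<^sub>C x \<in> T_Lie"
    if "x \<in> T_Lie" "y \<in> T_Lie" for x y :: "'a tensor" and c
    using subalgebra_T_Lie that unfolding subalgebra_def by blast+
  have diff: "x - y \<in> T_Lie" if "x \<in> T_Lie" "y \<in> T_Lie" for x y :: "'a tensor"
    using T_add[OF that(1) scale[OF that(2) that(2), of "-1"]] by simp
  \<comment> \<open>This is a Leibniz rule:
    \<open>d (a * b) = l a * d b + l b * d a - d a * d b\<close>, multiplied by
    \<open>d c\<close>.\<close>
  have anti: "d c * d b * l a + d c * d a * l b \<in> T_Lie" for a b c
  proof -
    have "d c * d b * l a + d c * d a * l b = d c * d (a * b) + d c * d a * d b"
      by (simp add: d_def l_mult r_mult algebra_simps)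
    then show ?thesis by (simp add: T_add mult d_T)
  qed
  have ddl: "d b * d c * l a \<in> T_Lie" for a b c
  proof -
    \<comment> \<open>Three cyclic instances of \<open>anti\<close> with signs +, -, +: since the
      two \<open>d\<close> factors commute, all terms other than \<open>?p\<close> cancel and
      \<open>?p\<close> appears twice.\<close>
    let ?p = "d b * d c * l a"
    have "(d c * d b * l a + d c * d a * l b) - (d a * d c * l b + d a * d b * l c)
        + (d b * d a * l c + d b * d c * l a) \<in> T_Lie"
      by (intro T_add diff anti)
    also have "(d c * d b * l a + d c * d a * l b) - (d a * d c * l b + d a * d b * l c)
        + (d b * d a * l c + d b * d c * l a) = ?p + ?p"
      by (simp add: mult.commute[of "d c"] mult.commute[of "d b" "d a"])
    finally have "(1 / 2) *\<^sub>C (?p + ?p) \<in> T_Lie" using scale by blast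
    moreover have "(1 / 2) *\<^sub>C (?p + ?p) = (1 / 2 + 1 / 2) *\<^sub>C ?p"
      by (simp only: scaleC_add_left scaleC_add_right)
    ultimately show ?thesis by (simp add: scaleC_one)
  qed
  have "v * (d a * d b) \<in> T_Lie"
  proof (induction v rule: tensor_induct)
    case zero
    show ?case using subalgebra_T_Lie[where 'a = 'a] by (simp add: subalgebra_def)
  next
    case (add e f u)
    \<comment> \<open>Substituting \<open>r f = l f - d f\<close> leaves only left multipliers,
      which \<open>ddl\<close> handles, and one further factor \<open>d f\<close> from
      \<open>T_Lie\<close>.\<close>
    have "e \<otimes>\<^sub>t f = l e * r f" by (simp add: l_def r_def pure_mult)
    then have "e \<otimes>\<^sub>t f * (d a * d b) = d a * d b * l (e * f) - (d a * d b * l e) * d f"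
      by (simp add: d_def[of f] l_mult algebra_simps)
    then have "e \<otimes>\<^sub>t f * (d a * d b) \<in> T_Lie" by (simp add: diff mult ddl d_T)
    with add.IH show ?case by (simp add: distrib_right T_add)
  qed
  then show ?thesis by (simp add: d_def l_def r_def)
qed

subsection \<open>Spectral synthesis of the diagonal\<close>

text \<open>Covers both ideals to be compared. The squares force the two restrictions of a character
  to the factors to agree; conversely, a diagonal character factors through multiplication and so
  kills \<open>N_Lie\<close>.\<close>

lemma ideal_hull_between:
  fixes I :: "'a::complex_comm_banach_algebra_1 tensor set"
  assumes I_sub: "I \<subseteq> N_Lie"
    and sq: "\<And>a. (a \<otimes>\<^sub>t 1 - 1 \<otimes>\<^sub>t a) * (a \<otimes>\<^sub>t 1 - 1 \<otimes>\<^sub>t a) \<in> I"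
  shows "ideal_hull (of_tensor ` I) = diagonal"
proof
  show "ideal_hull (of_tensor ` I) \<subseteq> diagonal"
  proof
    fix \<phi> assume \<phi>: "\<phi> \<in> ideal_hull (of_tensor ` I)"
    then have char: "\<phi> \<in> char_space" and vanish: "\<And>u. u \<in> I \<Longrightarrow> \<phi> (of_tensor u) = 0"
      by (auto simp: ideal_hull_def)
    note lin = char_space_clinear[OF char] and mul = char_space_mult[OF char]
    \<comment> \<open>The restriction to the first factor is the candidate for the point of the
      diagonal.\<close>
    define x where "x a = \<phi> (of_tensor (a \<otimes>\<^sub>t 1))" for a
    have right: "\<phi> (of_tensor (1 \<otimes>\<^sub>t a)) = x a" for a
      using vanish[OF sq[of a]]
      by (simp add: of_tensor_mult of_tensor_diff mul clinear_diff[OF lin] x_def)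
    have split: "\<phi> (of_tensor (a \<otimes>\<^sub>t b)) = x a * x b" for a b
    proof -
      have "a \<otimes>\<^sub>t b = (a \<otimes>\<^sub>t 1) * (1 \<otimes>\<^sub>t b)" by (simp add: pure_mult)
      then show ?thesis by (simp add: of_tensor_mult mul right x_def)
    qed
    have "x (a + b) = x a + x b" and "x (c *\<^sub>C a) = c * x a" for a b c
      using lin by (simp_all add: x_def pure_add_left pure_scale_left of_tensor_add
          of_tensor_scaleC clinear_def)
    moreover have "x (a * b) = x a * x b" for a b
    proof -
      have "(a * b) \<otimes>\<^sub>t 1 = (a \<otimes>\<^sub>t 1) * (b \<otimes>\<^sub>t 1)" by (simp add: pure_mult)
      then show ?thesis by (simp add: of_tensor_mult mul x_def)
    qed
    \<comment> \<open>\<open>x 1\<close> is the value of \<open>\<phi>\<close> at the unit, whose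
      vanishing would make \<open>\<phi>\<close> zero.\<close>
    moreover have "x 1 \<noteq> 0"
    proof
      assume "x 1 = 0"
      then have "\<phi> 1 = 0" by (simp add: x_def of_tensor_one flip: one_tensor)
      then have "\<phi> u = 0" for u using mul[of 1 u] by simp
      then show False using char by (auto simp: char_space_def)
    qed
    ultimately have "x \<in> char_space" by (auto simp: char_space_def clinear_def)
    then show "\<phi> \<in> diagonal" using char split by (auto simp: diagonal_def)
  qed
  show "diagonal \<subseteq> ideal_hull (of_tensor ` I)"
  proof
    fix \<phi> :: "'a ptensor \<Rightarrow> complex" assume "\<phi> \<in> diagonal"
    then obtain x where char: "\<phi> \<in> char_space" and x: "x \<in> char_space"
      and split: "\<And>a b. \<phi> (of_tensor (a \<otimes>\<^sub>t b)) = x a * x b"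
      by (auto simp: diagonal_def)
    note lin = char_space_clinear[OF char] and linx = char_space_clinear[OF x]
    have "\<phi> (of_tensor (\<Sum>(a, b)\<leftarrow>xs. a \<otimes>\<^sub>t b)) = x (\<Sum>(a, b)\<leftarrow>xs. a * b)" for xs
      using lin linx
      by (induction xs)
        (auto simp: of_tensor_zero of_tensor_add clinear_zero split char_space_mult[OF x] clinear_def)
    then have "\<phi> (of_tensor u) = 0" if "u \<in> N_Lie" for u
      using that clinear_zero[OF linx] by (auto simp: N_Lie_def)
    then show "\<phi> \<in> ideal_hull (of_tensor ` I)"
      using char I_sub by (auto simp: ideal_hull_def)
  qed
qed

theorem mainTheorem9:
  assumes "regular_algebra TYPE('a::complex_comm_banach_algebra_1)"
    and "spectral_synthesis (diagonal :: ('a ptensor \<Rightarrow> complex) set)"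
  shows "closure (of_tensor ` (T_Lie :: 'a tensor set)) = closure (of_tensor ` N_Lie)"
proof -
  \<comment> \<open>The multiplier \<open>v\<close> makes \<open>K\<close> an ideal, as
    \<open>v * (r * u) = (v * r) * u\<close>; the choice \<open>v = 1\<close> puts \<open>K\<close>
    inside \<open>T_Lie\<close>.\<close>
  define K :: "'a tensor set" where "K = {u. \<forall>v. v * u \<in> T_Lie}"
  have K_T: "K \<subseteq> T_Lie"
    unfolding K_def by (metis (mono_tags, lifting) mem_Collect_eq mult_1 subsetI)
  have K_ideal: "tensor_ideal K"
    using subalgebra_T_Lie
    by (auto simp: tensor_ideal_def K_def subalgebra_def distrib_left simp flip: mult.assoc)
  have K_sq: "(a \<otimes>\<^sub>t 1 - 1 \<otimes>\<^sub>t a) * (a \<otimes>\<^sub>t 1 - 1 \<otimes>\<^sub>t a) \<in> K" for a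
    unfolding K_def using mult_pure_diff_pure_diff_in_T_Lie by blast
  have hull: "ideal_hull (closure (of_tensor ` K)) = diagonal"
    "ideal_hull (closure (of_tensor ` (N_Lie :: 'a tensor set))) = diagonal"
    unfolding ideal_hull_closure
    using K_T K_sq T_Lie_subset_N_Lie
    by (auto intro!: ideal_hull_between dest: subsetD)
  \<comment> \<open>Both closures are closed ideals with hull \<open>diagonal\<close>, so the
    uniqueness in spectral synthesis identifies them; the closure of \<open>T_Lie\<close> lies
    between them.\<close>
  have "closure (of_tensor ` K) = closure (of_tensor ` (N_Lie :: 'a tensor set))"
    using assms(2) hull closed_ideal_closure_of_tensor[OF K_ideal]
      closed_ideal_closure_of_tensor[OF tensor_ideal_N_Lie]
    unfolding spectral_synthesis_def by blast
  moreover have "closure (of_tensor ` K) \<subseteq> closure (of_tensor ` T_Lie)"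
    using K_T by (intro closure_mono image_mono)
  moreover have "closure (of_tensor ` T_Lie) \<subseteq> closure (of_tensor ` (N_Lie :: 'a tensor set))"
    by (intro closure_mono image_mono T_Lie_subset_N_Lie)
  ultimately show ?thesis by blast
qed

end
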